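(* Let $\mathcal H$ be a real or complex Hilbert space, let $m\ge1$ be an integer, let $(S_i)_{1\le i\le m}$ be closed affine subspaces of $\mathcal H$, and for every $i\in\{1,\ldots,m\}$ let $U_i=(S_i-S_i)^\bot$ be the orthogonal complement of the closed vector subspace $S_i-S_i$ parallel to $S_i$. If $(U_i)_{1\le i\le m}$ satisfies the inverse best approximation property, then $\bigcap_{i=1}^mS_i\neq\varnothing$. In particular, $\bigcap_{i=1}^mS_i\ne\varnothing$ if any one of the following holds (notation as in the context): (a) for every $i\in\{1,\ldots,m-1\}$ and every $u_i\in U_i$ there exists $x\in\mathcal H$ such that $P_ix=u_i$ and $P_jx=0$ for every $j\in\{i+1,\ldots,m\}$; (b) for every $i\in\{1,\ldots,m-1\}$, $P_i(U_{i+}^\bot)=U_i$; (c) for every $i\in\{1,\ldots,m-1\}$, $U_i^\bot+U_{i+}^\bot=\mathcal H$; (d) the subspaces $(U_i)_{1\le i\le m}$ are linearly independent and, for every $i\in\{1,\ldots,m-1\}$, there exists $\gamma_i\in\,]0,+\infty[$ such that $d_{U_i^\bot\cap U_{i+}^\bot}\le\gamma_i(d_{U_i^\bot}+d_{U_{i+}^\bot})$ on $\mathcal H$; (e) the subspaces $(U_i)_{1\le i\le m}$ are linearly independent and, for every $i\in\{1,\ldots,m-1\}$, $U_i+U_{i+}$ is closed; (f) the subspaces $(U_i)_{1\le i\le m}$ are linearly independent and, for every $i\in\{1,\ldots,m-1\}$, $\mathsf c(U_i,U_{i+})<1$; (g) for every $i\in\{1,\ldots,m-1\}$ there exists $\gamma_i\in[1,+\infty[$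 such that $\|u_i\|\le\gamma_i\|P_{i+}^\bot u_i\|$ for every $u_i\in U_i$; (h) for every $i\in\{1,\ldots,m-1\}$ there exists $\gamma_i\in[2,+\infty[$ such that $\|x\|\le\gamma_i(\|P_i^\bot x\|+\|P_{i+}^\bot x\|)$ for every $x\in\mathcal H$; (i) for every $i\in\{1,\ldots,m-1\}$, $\|P_iP_{i+}\|<1$.
   Context: A closed affine subspace is a translate of a closed vector subspace (in particular it is nonempty). $P_i$ and $P_i^\bot$ are the orthogonal projectors onto $U_i$ and $U_i^\bot$. The family $(U_i)_{1\le i\le m}$ satisfies the inverse best approximation property (IBAP) if for every $(u_1,\ldots,u_m)\in U_1\times\cdots\times U_m$ there exists $x\in\mathcal H$ such that $P_ix=u_i$ for every $i\in\{1,\ldots,m\}$. For $i\in\{0,\ldots,m-1\}$: $U_{i+}=\sum_{j=i+1}^mU_j$ (algebraic sum), $P_{i+}$ is the orthogonal projector onto $\overline{U_{i+}}$, and $P_{i+}^\bot$ is the orthogonal projector onto $U_{i+}^\bot$. $d_S$ denotes the distance function to $S$. The subspaces $(U_i)$ are linearly independent if $u_i\in U_i$ for all $i$ and $\sum_{i=1}^mu_i=0$ imply $u_i=0$ for all $i$. For vector subspaces $U,V$ of $\mathcal H$, $\mathsf c(U,V)=\sup\{|\langle x\mid y\rangle| : x\in U\cap(U\cap V)^\bot,\ y\in V\cap(U\cap V)^\bot,\ \|x\|\le1,\ \|y\|\le1\}$. *)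

theory Defs
  imports "HOL-Analysis.Analysis"
begin

text \<open>
  Real and complex scalars are treated uniformly. An instance is a normed field over the reals
  with a conjugation for which \<open>z + conjugate z\<close> is real and \<open>z * conjugate z\<close> is the squared norm. Every
  element of such a field is a root of a monic quadratic polynomial with real coefficients, so up
  to isomorphism the instances are exactly the real and the complex numbers.
\<close>

class real_or_complex = real_normed_field +
  fixes conjugate :: "'a \<Rightarrow> 'a"
    and real_part :: "'a \<Rightarrow> real"
  assumes conjugate_add: "conjugate (x + y) = conjugate x + conjugate y"
    and conjugate_mult: "conjugate (x * y) = conjugate x * conjugate y"
    and conjugate_conjugate: "conjugate (conjugate x) = x"
    and add_conjugate: "x + conjugate x = (2 * real_part x) *\<^sub>R 1"
    and mult_conjugate: "x * conjugate x = (norm x)\<^sup>2 *\<^sub>R 1"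

instantiation real :: real_or_complex
begin
definition conjugate_real :: "real \<Rightarrow> real" where "conjugate_real x = x"
definition real_part_real :: "real \<Rightarrow> real" where "real_part_real x = x"
instance
  by standard (simp_all add: conjugate_real_def real_part_real_def power2_eq_square)
end

instantiation complex :: real_or_complex
begin
definition conjugate_complex :: "complex \<Rightarrow> complex" where "conjugate_complex = cnj"
definition real_part_complex :: "complex \<Rightarrow> real" where "real_part_complex = Re"
instance
  by standard
    (simp_all add: conjugate_complex_def real_part_complex_def complex_add_cnj scaleR_conv_of_real
      complex_norm_square [symmetric])
end

text \<open>
  The norm, topology and completeness of the Hilbert space are those of the \<open>banach\<close> type
  \<open>'a\<close>; the last assumption makes the norm the one induced by the inner product, and thereby
  yields positive definiteness. The inner product is linear in its first argument.
\<close>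

locale hilbert_space = vector_space smul
  for smul :: "'k::real_or_complex \<Rightarrow> 'a::banach \<Rightarrow> 'a" +
  fixes ip :: "'a \<Rightarrow> 'a \<Rightarrow> 'k"
  assumes smul_of_real: "smul (of_real r) x = r *\<^sub>R x"
    and ip_add_left: "ip (x + y) z = ip x z + ip y z"
    and ip_smul_left: "ip (smul c x) y = c * ip x y"
    and ip_conjugate: "ip y x = conjugate (ip x y)"
    and ip_self: "ip x x = of_real ((norm x)\<^sup>2)"

lemma hilbert_space_real:
  "hilbert_space scaleR (inner :: 'a::{real_inner, banach} \<Rightarrow> 'a \<Rightarrow> real)"
  by unfold_locales
    (simp_all add: conjugate_real_def inner_commute power2_norm_eq_inner algebra_simps)

lemma hilbert_space_complex:
  "hilbert_space (*) (\<lambda>x y :: complex. x * cnj y)"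
  by unfold_locales
    (simp_all add: conjugate_complex_def complex_norm_square [symmetric] scaleR_conv_of_real
      algebra_simps)

definition ortho :: "('a \<Rightarrow> 'a \<Rightarrow> 'k::real_or_complex) \<Rightarrow> 'a set \<Rightarrow> 'a set" where
  "ortho ip A = {x. \<forall>y\<in>A. ip x y = 0}"

text \<open>Orthogonal projector onto \<open>M\<close>; meaningful when \<open>M\<close> is a closed vector subspace.\<close>

definition proj :: "('a::ab_group_add \<Rightarrow> 'a \<Rightarrow> 'k::real_or_complex) \<Rightarrow> 'a set \<Rightarrow> 'a \<Rightarrow> 'a" where
  "proj ip M x = (THE p. p \<in> M \<and> x - p \<in> ortho ip M)"

definition closed_affine ::
  "('k::real_or_complex \<Rightarrow> 'a::real_normed_vector \<Rightarrow> 'a) \<Rightarrow> 'a set \<Rightarrow> bool" where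
  "closed_affine smul S \<longleftrightarrow>
     (\<exists>a M. module.subspace smul M \<and> closed M \<and> S = (\<lambda>v. a + v) ` M)"

text \<open>\<open>S - S\<close> in the sense of Minkowski, as opposed to the set difference \<open>S - S\<close> of HOL.\<close>

definition parallel_subspace :: "'a::ab_group_add set \<Rightarrow> 'a set" where
  "parallel_subspace S = {x - y |x y. x \<in> S \<and> y \<in> S}"

definition IBAP ::
  "('a::ab_group_add \<Rightarrow> 'a \<Rightarrow> 'k::real_or_complex) \<Rightarrow> nat \<Rightarrow> (nat \<Rightarrow> 'a set) \<Rightarrow> bool" where
  "IBAP ip m U \<longleftrightarrow>
     (\<forall>u. (\<forall>i\<in>{1..m}. u i \<in> U i) \<longrightarrow> (\<exists>x. \<forall>i\<in>{1..m}. proj ip (U i) x = u i))"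

text \<open>The sum of sets is the algebraic (Minkowski) sum of \<open>HOL-Library.Set_Algebras\<close>.\<close>

definition tail_sum :: "nat \<Rightarrow> (nat \<Rightarrow> 'a::comm_monoid_add set) \<Rightarrow> nat \<Rightarrow> 'a set" where
  "tail_sum m U i = (\<Sum>j\<in>{i+1..m}. U j)"

definition lin_independent :: "nat \<Rightarrow> (nat \<Rightarrow> 'a::comm_monoid_add set) \<Rightarrow> bool" where
  "lin_independent m U \<longleftrightarrow>
     (\<forall>u. (\<forall>i\<in>{1..m}. u i \<in> U i) \<and> (\<Sum>i\<in>{1..m}. u i) = 0 \<longrightarrow> (\<forall>i\<in>{1..m}. u i = 0))"

definition cosine ::
  "('a::real_normed_vector \<Rightarrow> 'a \<Rightarrow> 'k::real_or_complex) \<Rightarrow> 'a set \<Rightarrow> 'a set \<Rightarrow> real" where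
  "cosine ip U V = Sup {norm (ip x y) |x y.
     x \<in> U \<inter> ortho ip (U \<inter> V) \<and> y \<in> V \<inter> ortho ip (U \<inter> V) \<and> norm x \<le> 1 \<and> norm y \<le> 1}"

end

theory Submission
  imports Defs
begin

text \<open>
  Write \<open>S i = a i + M i\<close>, so that \<open>U i\<close> is the orthogonal complement of \<open>M i\<close>. The inverse best
  approximation property, applied to the projections of the points \<open>a i\<close>, provides a point \<open>x\<close>
  whose projection onto each \<open>U i\<close> equals that of \<open>a i\<close>. Then \<open>x - a i\<close> is orthogonal to \<open>U i\<close> and
  therefore lies in \<open>M i\<close>, the double orthogonal complement of \<open>M i\<close>; hence \<open>x\<close> is in every \<open>S i\<close>
  (\<open>IBAP_imp_Inter_nonempty\<close>).

  Each of the nine conditions yields the property by solving the equations \<open>P i x = u i\<close> one at a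
  time, from \<open>i = m\<close> down to \<open>i = 1\<close>. A correction of the \<open>i\<close>-th projection is harmless
  for the equations already solved if it is orthogonal to \<open>U j\<close> for every \<open>j > i\<close>. Condition (a) asks
  for corrections whose later projections vanish, and they exist as soon as the projector onto
  \<open>U = U i\<close> maps the orthogonal complement of \<open>V\<close>, the sum of the later subspaces, onto \<open>U\<close>
  (\<open>IBAP_if_surj\<close>). So (b) and (c) are immediate, and every
  other condition has to produce this surjectivity. Both ways of doing so rest on the fact that
  a bounded coercive operator on a closed subspace is onto (\<open>coercive_surj\<close>).

  For (f) to (i) the operator is \<open>P_U\<close> composed with the projector onto the complement of \<open>V\<close>,
  restricted to \<open>U\<close>. Its quadratic form at \<open>u\<close> is the squared distance of \<open>u\<close> to the closure of
  \<open>V\<close>, and each condition bounds this from below by a multiple of the squared norm of \<open>u\<close>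
  (\<open>surj_if_angle_bound\<close>).

  For (d) and (e) the operator is \<open>P_U + P_V\<close> on the closure of \<open>U + V\<close>, with \<open>V\<close> closed. It is coercive
  when \<open>norm z \<le> C * (norm (P_U z) + norm (P_V z))\<close> there. Under (d) this inequality is the
  given regularity rewritten with projectors; under (e) Baire's theorem gives it. If \<open>x\<close> solves
  \<open>P_U x + P_V x = u\<close> with \<open>u\<close> in \<open>U\<close>, then \<open>P_V x\<close> lies in the intersection of \<open>U\<close> and \<open>V\<close>, which is
  trivial by linear independence, so that \<open>x\<close> is orthogonal to \<open>V\<close> and \<open>P_U x = u\<close>. Since \<open>P_U + P_V\<close>
  being onto also makes \<open>U + V\<close> closed, the closedness of the sums of later subspaces propagates
  downwards (\<open>surj_if_independent_and_proj_sum_surj\<close>).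
\<close>

section \<open>The real inner product\<close>

lemma conjugate_zero: "conjugate (0::'k::real_or_complex) = 0"
  using conjugate_add[of "0::'k" 0] by simp

text \<open>That conjugation fixes the reals is forced by the rule for \<open>z * conjugate z\<close>.\<close>

lemma conjugate_of_real: "conjugate (of_real r :: 'k::real_or_complex) = of_real r"
proof (cases "r = 0")
  case False
  have "(of_real r :: 'k) * conjugate (of_real r) = of_real r * of_real r"
    by (simp add: mult_conjugate of_real_def power2_eq_square)
  with False show ?thesis by simp
qed (simp add: conjugate_zero)

lemma norm_conjugate: "norm (conjugate z) = norm (z::'k::real_or_complex)"
proof -
  have "(norm (conjugate z))\<^sup>2 *\<^sub>R (1::'k) = (norm z)\<^sup>2 *\<^sub>R 1"
    using mult_conjugate[of z] mult_conjugate[of "conjugate z"]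
    by (simp add: conjugate_conjugate mult.commute)
  then show ?thesis by simp
qed

lemma real_part_add: "real_part (x + y) = real_part x + real_part (y::'k::real_or_complex)"
proof -
  have "(2 * real_part (x + y)) *\<^sub>R (1::'k) = (2 * real_part x + 2 * real_part y) *\<^sub>R 1"
    unfolding scaleR_add_left add_conjugate[symmetric] by (simp add: conjugate_add)
  then show ?thesis by simp
qed

lemma real_part_conjugate: "real_part (conjugate x) = real_part (x::'k::real_or_complex)"
proof -
  have "(2 * real_part (conjugate x)) *\<^sub>R (1::'k) = (2 * real_part x) *\<^sub>R 1"
    unfolding add_conjugate[symmetric] by (simp add: conjugate_conjugate add.commute)
  then show ?thesis by simp
qed

lemma real_part_of_real_mult:
  "real_part (of_real r * x) = r * real_part (x::'k::real_or_complex)"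
proof -
  have "(2 * real_part (of_real r * x)) *\<^sub>R (1::'k) = of_real r * (x + conjugate x)"
    unfolding add_conjugate[symmetric]
    by (simp add: conjugate_mult conjugate_of_real distrib_left)
  also have "\<dots> = (2 * (r * real_part x)) *\<^sub>R 1"
    unfolding add_conjugate by (simp add: scaleR_conv_of_real mult_ac)
  finally show ?thesis by simp
qed

lemma real_part_of_real: "real_part (of_real r :: 'k::real_or_complex) = r"
proof -
  have "real_part (1::'k) = 1"
  proof -
    have "(2 * real_part (1::'k)) *\<^sub>R (1::'k) = 2 *\<^sub>R 1"
      unfolding add_conjugate[symmetric] using conjugate_of_real[of 1, where 'k='k]
      by (simp add: scaleR_2)
    then show ?thesis by simp
  qed
  then show ?thesis using real_part_of_real_mult[of r "1::'k"] by simp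
qed

context hilbert_space
begin

text \<open>For subspaces over the scalar field, orthogonality in the sense of \<open>ip\<close> and of its real part
  coincide, so that projections and estimates can be handled with a real symmetric form.\<close>

definition rip :: "'a \<Rightarrow> 'a \<Rightarrow> real" where
  "rip x y = real_part (ip x y)"

lemma rip_commute: "rip x y = rip y x"
  unfolding rip_def by (metis ip_conjugate real_part_conjugate)

lemma rip_self: "rip x x = (norm x)\<^sup>2"
  by (simp add: rip_def ip_self real_part_of_real del: of_real_power)

lemma rip_add_left: "rip (x + y) z = rip x z + rip y z"
  by (simp add: rip_def ip_add_left real_part_add)

lemma rip_scaleR_left: "rip (r *\<^sub>R x) y = r * rip x y"
  by (simp add: rip_def smul_of_real[symmetric] ip_smul_left real_part_of_real_mult)

lemma rip_add_right: "rip z (x + y) = rip z x + rip z y"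
  by (metis rip_add_left rip_commute)

lemma rip_scaleR_right: "rip y (r *\<^sub>R x) = r * rip y x"
  by (metis rip_scaleR_left rip_commute)

lemma rip_minus_left: "rip (- x) y = - rip x y"
  using rip_scaleR_left[of "-1"] by simp

lemma rip_minus_right: "rip y (- x) = - rip y x"
  using rip_scaleR_right[of _ "-1"] by simp

lemma rip_diff_left: "rip (x - y) z = rip x z - rip y z"
  using rip_add_left[of x "- y"] by (simp add: rip_minus_left)

lemma rip_diff_right: "rip z (x - y) = rip z x - rip z y"
  using rip_add_right[of z x "- y"] by (simp add: rip_minus_right)

lemma rip_zero_left [simp]: "rip 0 y = 0"
  using rip_scaleR_left[of 0] by simp

lemma rip_zero_right [simp]: "rip y 0 = 0"
  using rip_scaleR_right[of _ 0] by simp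

lemmas rip_simps = rip_add_left rip_add_right rip_scaleR_left rip_scaleR_right
  rip_diff_left rip_diff_right

lemma norm_add_sq: "(norm (x + y))\<^sup>2 = (norm x)\<^sup>2 + 2 * rip x y + (norm y)\<^sup>2"
  unfolding rip_self[symmetric] by (simp add: rip_simps rip_commute)

lemma norm_diff_sq: "(norm (x - y))\<^sup>2 = (norm x)\<^sup>2 - 2 * rip x y + (norm y)\<^sup>2"
  unfolding rip_self[symmetric] by (simp add: rip_simps rip_commute)

lemma rip_le: "\<bar>rip x y\<bar> \<le> norm x * norm y"
proof (cases "y = 0")
  case False
  have "0 \<le> (norm ((norm y)\<^sup>2 *\<^sub>R x - rip x y *\<^sub>R y))\<^sup>2" by simp
  also have "\<dots> = (norm y)\<^sup>2 * ((norm x)\<^sup>2 * (norm y)\<^sup>2 - (rip x y)\<^sup>2)"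
    unfolding norm_diff_sq
    by (simp add: rip_simps power_mult_distrib power2_eq_square algebra_simps)
  finally have "(rip x y)\<^sup>2 \<le> (norm x * norm y)\<^sup>2"
    using False by (simp add: zero_le_mult_iff power_mult_distrib)
  then show ?thesis
    using abs_le_square_iff[of "rip x y" "norm x * norm y"] by (simp add: abs_mult)
qed simp

lemma bounded_bilinear_rip: "bounded_bilinear rip"
proof
  show "\<exists>K. \<forall>a b. norm (rip a b) \<le> norm a * norm b * K"
    by (rule exI[of _ 1]) (simp add: rip_le)
qed (simp_all add: rip_simps)

lemma ip_eq_0_commute: "ip x y = 0 \<longleftrightarrow> ip y x = 0"
  by (metis ip_conjugate conjugate_zero)

lemma ip_smul_right: "ip x (smul c y) = conjugate c * ip x y"
  by (metis conjugate_mult ip_conjugate ip_smul_left)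

text \<open>Multiplying \<open>x\<close> by the conjugate of \<open>ip x y\<close> rotates the scalar product onto the
  nonnegative reals. This one identity transfers both orthogonality and the Cauchy-Schwarz inequality from
  the real inner product to the given one.\<close>

lemma rip_rotate: "rip (smul (conjugate (ip x y)) x) y = (norm (ip x y))\<^sup>2"
proof -
  have "conjugate (ip x y) * ip x y = of_real ((norm (ip x y))\<^sup>2)"
    using mult_conjugate[of "ip x y"] by (simp add: mult.commute of_real_def)
  then show ?thesis by (simp add: rip_def ip_smul_left real_part_of_real del: of_real_power)
qed

lemma norm_smul: "norm (smul c x) = norm c * norm x"
proof -
  have "ip (smul c x) (smul c x) = (c * conjugate c) * ip x x"
    by (simp add: ip_smul_left ip_smul_right)
  also have "\<dots> = of_real ((norm c * norm x)\<^sup>2)"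
    by (simp add: mult_conjugate ip_self power_mult_distrib scaleR_conv_of_real)
  finally have "(norm (smul c x))\<^sup>2 = (norm c * norm x)\<^sup>2"
    unfolding ip_self of_real_eq_iff .
  then show ?thesis by (simp add: power2_eq_iff_nonneg)
qed

lemma norm_ip_le: "norm (ip x y) \<le> norm x * norm y"
proof (cases "ip x y = 0")
  case False
  have "(norm (ip x y))\<^sup>2 \<le> norm (smul (conjugate (ip x y)) x) * norm y"
    using rip_le[of "smul (conjugate (ip x y)) x" y] by (simp add: rip_rotate)
  also have "\<dots> = norm (ip x y) * (norm x * norm y)"
    by (simp add: norm_smul norm_conjugate)
  finally show ?thesis using False by (simp add: power2_eq_square)
qed simp

lemma rip_le_norm_ip: "rip x y \<le> norm (ip x y)"
proof (cases "ip x y = 0")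
  case True
  then show ?thesis using real_part_of_real[of 0, where 'k='k] by (simp add: rip_def)
next
  case False
  let ?z = "ip x y"
  have "(2 * real_part ?z) *\<^sub>R (1::'k) = ?z + conjugate ?z"
    by (simp add: add_conjugate)
  then have "norm ((2 * real_part ?z) *\<^sub>R (1::'k)) \<le> norm ?z + norm (conjugate ?z)"
    by (metis norm_triangle_ineq)
  then show ?thesis by (simp add: norm_conjugate rip_def)
qed

section \<open>Orthogonal projections\<close>

lemma scaleR_mem: "subspace M \<Longrightarrow> x \<in> M \<Longrightarrow> r *\<^sub>R x \<in> M"
  by (metis smul_of_real subspace_scale)

lemma ortho_iff_rip:
  assumes "subspace M"
  shows "x \<in> ortho ip M \<longleftrightarrow> (\<forall>y\<in>M. rip x y = 0)"
proof
  show "\<forall>y\<in>M. rip x y = 0" if "x \<in> ortho ip M"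
    using that real_part_of_real[of 0, where 'k='k] by (auto simp: ortho_def rip_def)
next
  assume *: "\<forall>y\<in>M. rip x y = 0"
  have "ip x y = 0" if "y \<in> M" for y
  proof -
    have "rip y x = 0" "rip (smul (conjugate (ip y x)) y) x = 0"
      using * that assms by (auto simp: rip_commute[of _ x] subspace_scale)
    then have "ip y x = 0" by (simp add: rip_rotate)
    then show ?thesis by (simp add: ip_eq_0_commute[of x])
  qed
  then show "x \<in> ortho ip M" by (simp add: ortho_def)
qed

lemma subspace_ortho: "subspace (ortho ip A)"
  by (rule subspaceI) (auto simp: ortho_def ip_add_left ip_smul_left
      intro: ip_smul_left[of 0 0, simplified])

lemma closed_ortho:
  assumes "subspace M" shows "closed (ortho ip M)"
proof -
  have "ortho ip M = (\<Inter>y\<in>M. {x. rip x y = 0})"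
    using ortho_iff_rip[OF assms] by auto
  moreover have "closed {x. rip x y = 0}" for y
    by (intro closed_Collect_eq continuous_intros
        bounded_linear.continuous_on[OF bounded_bilinear.bounded_linear_left[OF bounded_bilinear_rip]])
  ultimately show ?thesis by auto
qed

text \<open>The projection of \<open>x\<close> is the limit of a sequence in \<open>M\<close> that minimises the distance to \<open>x\<close>;
  a minimiser leaves a residual orthogonal to \<open>M\<close> because moving it within \<open>M\<close> cannot help.\<close>

lemma exists_projection:
  assumes M: "subspace M" and "closed M"
  shows "\<exists>p\<in>M. x - p \<in> ortho ip M"
proof -
  have ne: "M \<noteq> {}" using subspace_0[OF M] by auto
  define d where "d = infdist x M"
  have d_le: "d \<le> norm (x - y)" if "y \<in> M" for y
    using infdist_le[OF that, of x] by (simp add: d_def dist_norm)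
  have d0: "0 \<le> d" by (simp add: d_def infdist_nonneg)
  have "\<exists>y\<in>M. norm (x - y) < d + inverse (real (Suc n))" for n
  proof -
    have "bdd_below (dist x ` M)" by (rule bdd_belowI2[of _ 0]) simp
    moreover have "(INF y\<in>M. dist x y) < d + inverse (real (Suc n))"
      using ne by (simp add: d_def infdist_notempty)
    ultimately show ?thesis
      using cINF_less_iff[OF ne, of "dist x"] by (simp add: dist_norm)
  qed
  then obtain y where y: "\<And>n. y n \<in> M" "\<And>n. norm (x - y n) < d + inverse (real (Suc n))"
    by metis
  have lim: "(\<lambda>n. norm (x - y n)) \<longlonglongrightarrow> d"
  proof (rule tendsto_sandwich[of "\<lambda>_. d" _ _ "\<lambda>n. d + inverse (real (Suc n))"])
    show "\<forall>\<^sub>F n in sequentially. norm (x - y n) \<le> d + inverse (real (Suc n))"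
      using y(2) by (intro always_eventually allI less_imp_le)
    show "(\<lambda>n. d + inverse (real (Suc n))) \<longlonglongrightarrow> d"
      using tendsto_add[OF tendsto_const LIMSEQ_inverse_real_of_nat, of d] by simp
  qed (auto intro!: always_eventually d_le y)
  \<comment> \<open>By the parallelogram law two nearly optimal points are close to each other, since their
    midpoint cannot be nearer to \<open>x\<close> than \<open>d\<close>.\<close>
  have par: "(norm (y k - y l))\<^sup>2 \<le> 2 * (norm (x - y k))\<^sup>2 + 2 * (norm (x - y l))\<^sup>2 - 4 * d\<^sup>2" for k l
  proof -
    have "(1/2) *\<^sub>R (y k + y l) \<in> M" using y M by (intro scaleR_mem subspace_add) auto
    from power_mono[OF d_le[OF this] d0, of 2]
    have "4 * d\<^sup>2 \<le> (norm (2 *\<^sub>R (x - (1/2) *\<^sub>R (y k + y l))))\<^sup>2"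
      by (simp add: power_mult_distrib)
    also have "2 *\<^sub>R (x - (1/2) *\<^sub>R (y k + y l)) = (x - y k) + (x - y l)"
      by (simp add: algebra_simps scaleR_2)
    finally have "4 * d\<^sup>2 \<le> (norm ((x - y k) + (x - y l)))\<^sup>2" .
    moreover have "y k - y l = (x - y l) - (x - y k)" by simp
    then have "(norm (y k - y l))\<^sup>2 = (norm ((x - y l) - (x - y k)))\<^sup>2" by simp
    ultimately show ?thesis
      unfolding norm_diff_sq[of "x - y l"] norm_add_sq rip_commute[of "x - y l"] by linarith
  qed
  have "Cauchy y"
  proof (rule metric_CauchyI)
    fix e :: real assume e: "e > 0"
    have "(\<lambda>n. (norm (x - y n))\<^sup>2) \<longlonglongrightarrow> d\<^sup>2" by (intro tendsto_intros lim)
    then have "\<forall>\<^sub>F n in sequentially. (norm (x - y n))\<^sup>2 < d\<^sup>2 + e\<^sup>2 / 4"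
      using e by (intro order_tendstoD) auto
    then obtain N where N: "\<And>n. n \<ge> N \<Longrightarrow> (norm (x - y n))\<^sup>2 < d\<^sup>2 + e\<^sup>2 / 4"
      by (auto simp: eventually_sequentially)
    have "dist (y k) (y l) < e" if "k \<ge> N" "l \<ge> N" for k l
    proof -
      have "(norm (y k - y l))\<^sup>2 < e\<^sup>2"
        using par[of k l] N[OF that(1)] N[OF that(2)] by linarith
      then show ?thesis unfolding dist_norm by (rule power2_less_imp_less) (use e in simp)
    qed
    then show "\<exists>N. \<forall>k\<ge>N. \<forall>l\<ge>N. dist (y k) (y l) < e" by blast
  qed
  then obtain p where p: "y \<longlonglongrightarrow> p" by (auto simp: Cauchy_convergent_iff convergent_def)
  have pM: "p \<in> M" using closed_sequentially[OF \<open>closed M\<close> _ p] y by blast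
  have nd: "norm (x - p) = d"
    by (rule LIMSEQ_unique[OF _ lim]) (intro tendsto_intros p)
  have "rip (x - p) z = 0" if z: "z \<in> M" for z
  proof (cases "z = 0")
    case False
    \<comment> \<open>The step for which \<open>p + t z\<close> is the best approximation to \<open>x\<close> on the line through \<open>p\<close>.\<close>
    define t where "t = rip (x - p) z / (norm z)\<^sup>2"
    have "p + t *\<^sub>R z \<in> M" using pM z M by (intro scaleR_mem subspace_add) auto
    from power_mono[OF d_le[OF this] d0, of 2]
    have "(norm (x - p))\<^sup>2 \<le> (norm ((x - p) - t *\<^sub>R z))\<^sup>2" by (simp add: nd diff_diff_eq)
    also have "\<dots> = (norm (x - p))\<^sup>2 - 2 * t * rip (x - p) z + t\<^sup>2 * (norm z)\<^sup>2"
      unfolding norm_diff_sq by (simp add: rip_simps power_mult_distrib)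
    also have "\<dots> = (norm (x - p))\<^sup>2 - (rip (x - p) z)\<^sup>2 / (norm z)\<^sup>2"
      using False by (simp add: t_def field_simps power2_eq_square)
    finally show ?thesis using False by (auto simp: divide_le_0_iff)
  qed simp
  with pM show ?thesis using ortho_iff_rip[OF M] by blast
qed

lemma ortho_Int: "x \<in> M \<Longrightarrow> x \<in> ortho ip M \<Longrightarrow> x = 0"
  by (auto simp: ortho_def ip_self)

lemma proj_eqI:
  assumes M: "subspace M" and "p \<in> M" "x - p \<in> ortho ip M"
  shows "proj ip M x = p"
  unfolding proj_def
proof (rule the_equality)
  fix q assume q: "q \<in> M \<and> x - q \<in> ortho ip M"
  have "q - p = (x - p) - (x - q)" by simp
  then have "q - p \<in> ortho ip M" using q assms by (metis subspace_diff subspace_ortho)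
  moreover have "q - p \<in> M" using q assms by (auto intro: subspace_diff)
  ultimately show "q = p" using ortho_Int by fastforce
qed (use assms in auto)

definition closed_subspace :: "'a set \<Rightarrow> bool" where
  "closed_subspace M \<longleftrightarrow> subspace M \<and> closed M"

lemma closed_subspace_ortho: "subspace M \<Longrightarrow> closed_subspace (ortho ip M)"
  by (simp add: closed_subspace_def subspace_ortho closed_ortho)

lemma
  assumes "closed_subspace M"
  shows proj_mem: "proj ip M x \<in> M"
    and proj_diff_ortho: "x - proj ip M x \<in> ortho ip M"
  using exists_projection[of M x] proj_eqI[of M _ x] assms by (auto simp: closed_subspace_def)

lemma proj_add:
  assumes "closed_subspace M" shows "proj ip M (x + y) = proj ip M x + proj ip M y"
proof (rule proj_eqI)
  have "x + y - (proj ip M x + proj ip M y) = (x - proj ip M x) + (y - proj ip M y)" by simp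
  then show "x + y - (proj ip M x + proj ip M y) \<in> ortho ip M"
    using assms by (simp only: subspace_add subspace_ortho proj_diff_ortho)
qed (use assms in \<open>auto simp: closed_subspace_def intro!: subspace_add proj_mem\<close>)

lemma proj_scaleR:
  assumes "closed_subspace M" shows "proj ip M (r *\<^sub>R x) = r *\<^sub>R proj ip M x"
proof (rule proj_eqI)
  show "r *\<^sub>R x - r *\<^sub>R proj ip M x \<in> ortho ip M"
    using assms by (simp only: scaleR_diff_right[symmetric] scaleR_mem subspace_ortho proj_diff_ortho)
qed (use assms in \<open>auto simp: closed_subspace_def intro!: scaleR_mem proj_mem\<close>)

lemma proj_id: "closed_subspace M \<Longrightarrow> x \<in> M \<Longrightarrow> proj ip M x = x"
  by (rule proj_eqI) (auto simp: closed_subspace_def intro: subspace_0 subspace_ortho)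

lemma proj_ortho_0: "closed_subspace M \<Longrightarrow> x \<in> ortho ip M \<Longrightarrow> proj ip M x = 0"
  by (rule proj_eqI) (auto simp: closed_subspace_def intro: subspace_0)

lemma rip_ortho_0: "subspace M \<Longrightarrow> x \<in> ortho ip M \<Longrightarrow> y \<in> M \<Longrightarrow> rip x y = 0"
  by (simp add: ortho_iff_rip)

lemma rip_proj:
  assumes "closed_subspace M" and "y \<in> M"
  shows "rip (proj ip M x) y = rip x y"
  using rip_ortho_0[of M "x - proj ip M x" y] assms proj_diff_ortho
  by (simp add: closed_subspace_def rip_simps)

lemma norm_proj_sq: "closed_subspace M \<Longrightarrow> rip (proj ip M x) x = (norm (proj ip M x))\<^sup>2"
  by (metis rip_proj proj_mem rip_commute rip_self)

lemma norm_proj_le: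
  assumes "closed_subspace M" shows "norm (proj ip M x) \<le> norm x"
proof -
  have "(norm (proj ip M x))\<^sup>2 \<le> norm (proj ip M x) * norm x"
    using norm_proj_sq[OF assms, of x] rip_le[of "proj ip M x" x] by simp
  then show ?thesis by (cases "norm (proj ip M x) = 0") (auto simp: power2_eq_square)
qed

lemma bounded_linear_proj:
  assumes "closed_subspace M" shows "bounded_linear (proj ip M)"
  by (rule bounded_linear_intro[where K = 1])
    (simp_all add: assms proj_add proj_scaleR norm_proj_le)

lemma subset_ortho_ortho: "A \<subseteq> ortho ip (ortho ip A)"
proof
  fix x assume x: "x \<in> A"
  have "ip x y = 0" if "y \<in> ortho ip A" for y
    using that x by (simp add: ortho_def ip_eq_0_commute[of x])
  then show "x \<in> ortho ip (ortho ip A)" by (simp add: ortho_def)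
qed

lemma ortho_ortho:
  assumes "closed_subspace M" shows "ortho ip (ortho ip M) = M"
proof
  have M: "subspace M" using assms by (simp add: closed_subspace_def)
  show "M \<subseteq> ortho ip (ortho ip M)"
    by (rule subset_ortho_ortho)
  show "ortho ip (ortho ip M) \<subseteq> M"
  proof
    fix x assume x: "x \<in> ortho ip (ortho ip M)"
    let ?p = "proj ip M x"
    have "?p \<in> ortho ip (ortho ip M)"
      using \<open>M \<subseteq> _\<close> proj_mem[OF assms] by blast
    then have "x - ?p \<in> ortho ip (ortho ip M)" using x by (intro subspace_diff subspace_ortho)
    then have "x - ?p = 0" using proj_diff_ortho[OF assms] ortho_Int by blast
    then show "x \<in> M" using proj_mem[OF assms, of x] by simp
  qed
qed

lemma proj_ortho:
  assumes "closed_subspace M" shows "proj ip (ortho ip M) x = x - proj ip M x"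
proof (rule proj_eqI)
  show "x - (x - proj ip M x) \<in> ortho ip (ortho ip M)"
    using assms by (simp add: ortho_ortho proj_mem)
qed (auto simp: assms subspace_ortho proj_diff_ortho)

lemma ortho_closure:
  assumes "subspace M" shows "ortho ip (closure M) = ortho ip M"
proof
  show "ortho ip (closure M) \<subseteq> ortho ip M"
    using closure_subset by (force simp: ortho_def)
  show "ortho ip M \<subseteq> ortho ip (closure M)"
  proof
    fix x assume x: "x \<in> ortho ip M"
    have "closure M \<subseteq> ortho ip (ortho ip M)"
      by (intro closure_minimal closed_ortho subspace_ortho subset_ortho_ortho)
    then have "ip y x = 0" if "y \<in> closure M" for y
      using that x by (auto simp: ortho_def)
    then show "x \<in> ortho ip (closure M)"
      by (simp add: ortho_def ip_eq_0_commute[of x])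
  qed
qed

lemma closed_subspace_closure:
  assumes "subspace M" shows "closed_subspace (closure M)"
proof -
  have smul: "bounded_linear (smul c)" for c
    by (rule bounded_linear_intro[where K = "norm c"])
      (simp_all add: scale_right_distrib norm_smul smul_of_real[symmetric] mult.commute)
  have "subspace (closure M)"
  proof (rule subspaceI)
    show "0 \<in> closure M" using subspace_0[OF assms] closure_subset by blast
    show "x + y \<in> closure M" if xy: "x \<in> closure M" "y \<in> closure M" for x y
    proof -
      obtain f g where "\<forall>n. f n \<in> M" "f \<longlonglongrightarrow> x" "\<forall>n. g n \<in> M" "g \<longlonglongrightarrow> y"
        using xy unfolding closure_sequential by (elim exE conjE)
      then have "\<forall>n. f n + g n \<in> M" "(\<lambda>n. f n + g n) \<longlonglongrightarrow> x + y"
        using subspace_add[OF assms] tendsto_add by simp_all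
      then show ?thesis unfolding closure_sequential by (intro exI conjI)
    qed
    show "smul c x \<in> closure M" if x: "x \<in> closure M" for c x
    proof -
      obtain f where "\<forall>n. f n \<in> M" "f \<longlonglongrightarrow> x"
        using x unfolding closure_sequential by (elim exE conjE)
      then have "\<forall>n. smul c (f n) \<in> M" "(\<lambda>n. smul c (f n)) \<longlonglongrightarrow> smul c x"
        using subspace_scale[OF assms] bounded_linear.tendsto[OF smul] by simp_all
      then show ?thesis unfolding closure_sequential by (intro exI conjI)
    qed
  qed
  then show ?thesis by (simp add: closed_subspace_def)
qed

lemma subspace_set_plus:
  assumes "subspace A" "subspace B" shows "subspace (A + B)"
proof -
  have "A + B = {x + y |x y. x \<in> A \<and> y \<in> B}" by (auto simp: set_plus_def)
  then show ?thesis using subspace_sums[OF assms] by simp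
qed

section \<open>Coercive operators and the surjectivity of restricted projectors\<close>

text \<open>For small \<open>t\<close> the map \<open>x \<mapsto> x - t (T x - w)\<close> is a contraction of \<open>Z\<close>, because expanding the
  square gives the factor \<open>1 - 2 t a + (t b)^2\<close>, where \<open>b\<close> bounds the norm of \<open>T\<close>. Its fixed point solves
  the equation. This is the Lax-Milgram theorem for an operator on \<open>Z\<close>.\<close>

lemma coercive_surj:
  assumes Z: "closed_subspace Z" and T: "bounded_linear T" and TZ: "T ` Z \<subseteq> Z"
    and a: "a > 0" and coercive: "\<And>x. x \<in> Z \<Longrightarrow> a * (norm x)\<^sup>2 \<le> rip (T x) x"
    and w: "w \<in> Z"
  shows "\<exists>x\<in>Z. T x = w"
proof -
  interpret T: bounded_linear T by fact
  obtain b0 where b0: "b0 > 0" "\<And>x. norm (T x) \<le> norm x * b0"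
    using T.pos_bounded by blast
  \<comment> \<open>Enlarging the bound beyond \<open>a\<close> keeps \<open>1 - (a / b)^2\<close> positive, even for \<open>Z = {0}\<close>, where
    coercivity does not relate \<open>a\<close> to the norm of \<open>T\<close>.\<close>
  define b where "b = b0 + a"
  have b: "b > 0" "a < b" using b0(1) a by (simp_all add: b_def)
  have Tb: "norm (T x) \<le> b * norm x" for x
  proof -
    have "norm x * b0 \<le> norm x * b" using a by (intro mult_left_mono) (simp_all add: b_def)
    with b0(2)[of x] show ?thesis by (simp add: mult.commute)
  qed
  \<comment> \<open>The minimiser of \<open>1 - 2 t a + (t b)^2\<close>.\<close>
  define t where "t = a / b\<^sup>2"
  define c where "c = sqrt (1 - (a / b)\<^sup>2)"
  have ab: "(a / b)\<^sup>2 < 1" using a b by (simp add: power2_eq_square mult_strict_mono)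
  have c: "0 \<le> c" "c < 1" using ab a b by (auto simp: c_def)
  have c2: "c\<^sup>2 = 1 - (a / b)\<^sup>2" using ab by (simp add: c_def)
  have t: "t > 0" using a b by (simp add: t_def)
  have contr: "norm (x - t *\<^sub>R T x) \<le> c * norm x" if x: "x \<in> Z" for x
  proof -
    have ta: "t * a = (a / b)\<^sup>2" "t\<^sup>2 * b\<^sup>2 = (a / b)\<^sup>2"
      using b(1) by (simp_all add: t_def power_divide power2_eq_square)
    have "2 * t * (a * (norm x)\<^sup>2) \<le> 2 * t * rip (T x) x"
      using t coercive[OF x] by (intro mult_left_mono) simp_all
    then have "2 * (a / b)\<^sup>2 * (norm x)\<^sup>2 \<le> 2 * t * rip (T x) x"
      unfolding ta(1)[symmetric] by (simp add: mult_ac)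
    moreover have "t\<^sup>2 * (norm (T x))\<^sup>2 \<le> t\<^sup>2 * (b * norm x)\<^sup>2"
      using power_mono[OF Tb, of x 2] by (intro mult_left_mono) simp_all
    then have "t\<^sup>2 * (norm (T x))\<^sup>2 \<le> (a / b)\<^sup>2 * (norm x)\<^sup>2"
      unfolding ta(2)[symmetric] by (simp add: power_mult_distrib mult_ac)
    moreover have "(norm (x - t *\<^sub>R T x))\<^sup>2
        = (norm x)\<^sup>2 - 2 * t * rip (T x) x + t\<^sup>2 * (norm (T x))\<^sup>2"
      unfolding norm_diff_sq by (simp add: rip_simps power_mult_distrib rip_commute)
    moreover have "(c * norm x)\<^sup>2 = (norm x)\<^sup>2 - (a / b)\<^sup>2 * (norm x)\<^sup>2"
      unfolding power_mult_distrib c2 left_diff_distrib by simp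
    ultimately have "(norm (x - t *\<^sub>R T x))\<^sup>2 \<le> (c * norm x)\<^sup>2" by linarith
    then show ?thesis by (rule power2_le_imp_le) (use c in simp)
  qed
  define f where "f x = x - t *\<^sub>R (T x - w)" for x
  have Zs: "subspace Z" "closed Z" using Z by (auto simp: closed_subspace_def)
  have "\<exists>!x\<in>Z. f x = x"
  proof (rule Banach_fix)
    show "complete Z" using Zs by (simp add: complete_eq_closed)
    show "Z \<noteq> {}" using w by auto
    show "f ` Z \<subseteq> Z"
      using Zs TZ w by (auto simp: f_def intro!: subspace_diff scaleR_mem)
    show "dist (f x) (f y) \<le> c * dist x y" if "x \<in> Z" "y \<in> Z" for x y
    proof -
      have "f x - f y = (x - y) - t *\<^sub>R T (x - y)"
        by (simp add: f_def T.diff algebra_simps)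
      then show ?thesis
        using contr[of "x - y"] that Zs by (simp add: dist_norm subspace_diff)
    qed
  qed (use c in auto)
  then obtain x where "x \<in> Z" "f x = x" by blast
  then show ?thesis using t by (auto simp: f_def)
qed

text \<open>The hypothesis is coercivity on \<open>U\<close> of the compression to \<open>U\<close> of the projector onto the
  complement of \<open>V\<close>: since projectors are symmetric and idempotent, the quadratic form of that
  operator at \<open>u\<close> is the right-hand side.\<close>

lemma surj_if_angle_bound:
  assumes U: "closed_subspace U" and V: "subspace V" and a: "a > 0"
    and le: "\<And>u. u \<in> U \<Longrightarrow> a * (norm u)\<^sup>2 \<le> (norm (proj ip (ortho ip V) u))\<^sup>2"
  shows "U \<subseteq> proj ip U ` ortho ip V"
proof
  fix u assume u: "u \<in> U"
  have V': "closed_subspace (ortho ip V)" using V by (rule closed_subspace_ortho)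
  have "\<exists>x\<in>U. proj ip U (proj ip (ortho ip V) x) = u"
  proof (rule coercive_surj[OF U _ _ a _ u])
    show "bounded_linear (\<lambda>x. proj ip U (proj ip (ortho ip V) x))"
      by (rule bounded_linear_compose[OF bounded_linear_proj[OF U] bounded_linear_proj[OF V']])
    show "(\<lambda>x. proj ip U (proj ip (ortho ip V) x)) ` U \<subseteq> U"
      using proj_mem[OF U] by auto
    show "a * (norm x)\<^sup>2 \<le> rip (proj ip U (proj ip (ortho ip V) x)) x" if "x \<in> U" for x
      using le[OF that] by (simp add: rip_proj[OF U that] norm_proj_sq[OF V'])
  qed
  then show "u \<in> proj ip U ` ortho ip V" using proj_mem[OF V'] by auto
qed

lemma surj_if_norm_le:
  assumes U: "closed_subspace U" and V: "subspace V" and g: "g > 0"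
    and le: "\<And>u. u \<in> U \<Longrightarrow> norm u \<le> g * norm (proj ip (ortho ip V) u)"
  shows "U \<subseteq> proj ip U ` ortho ip V"
proof (rule surj_if_angle_bound[OF U V, of "1 / g\<^sup>2"])
  show "1 / g\<^sup>2 * (norm u)\<^sup>2 \<le> (norm (proj ip (ortho ip V) u))\<^sup>2" if "u \<in> U" for u
    using power_mono[OF le[OF that], of 2] g by (simp add: power_mult_distrib field_simps)
qed (use g in simp)

text \<open>By Pythagoras, a bound on the component of \<open>u\<close> along \<open>V\<close> is one on the component across it.\<close>

lemma surj_if_rip_proj_le:
  assumes U: "closed_subspace U" and V: "subspace V" and q: "q < 1"
    and le: "\<And>u. u \<in> U \<Longrightarrow> rip (proj ip (closure V) u) u \<le> q * (norm u)\<^sup>2"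
  shows "U \<subseteq> proj ip U ` ortho ip V"
proof (rule surj_if_angle_bound[OF U V, of "1 - q"])
  fix u assume u: "u \<in> U"
  have "proj ip (ortho ip V) u = u - proj ip (closure V) u"
    using proj_ortho[OF closed_subspace_closure[OF V]] by (simp add: ortho_closure[OF V])
  then have "(norm (proj ip (ortho ip V) u))\<^sup>2 = (norm u)\<^sup>2 - rip (proj ip (closure V) u) u"
    using norm_proj_sq[OF closed_subspace_ortho[OF V], of u] by (simp add: rip_simps rip_self)
  then show "(1 - q) * (norm u)\<^sup>2 \<le> (norm (proj ip (ortho ip V) u))\<^sup>2"
    using le[OF u] by (simp add: algebra_simps)
qed (use q in simp)

lemma surj_if_onorm_less_1:
  assumes U: "closed_subspace U" and V: "subspace V"
    and less: "onorm (proj ip U \<circ> proj ip (closure V)) < 1"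
  shows "U \<subseteq> proj ip U ` ortho ip V"
proof (rule surj_if_rip_proj_le[OF U V less])
  fix u assume u: "u \<in> U"
  let ?Q = "proj ip U \<circ> proj ip (closure V)"
  have "bounded_linear ?Q"
    unfolding o_def
    by (rule bounded_linear_compose[OF bounded_linear_proj[OF U]
          bounded_linear_proj[OF closed_subspace_closure[OF V]]])
  then have "norm (?Q u) \<le> onorm ?Q * norm u" by (rule onorm)
  then have "norm (?Q u) * norm u \<le> (onorm ?Q * norm u) * norm u"
    by (rule mult_right_mono) simp
  moreover have "rip (proj ip (closure V) u) u \<le> norm (?Q u) * norm u"
    using rip_le[of "?Q u" u] by (simp add: rip_proj[OF U u])
  ultimately show "rip (proj ip (closure V) u) u \<le> onorm ?Q * (norm u)\<^sup>2"
    by (simp add: power2_eq_square mult.assoc)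
qed

text \<open>If the intersection is trivial, its orthogonal complement is the whole space, so \<open>cosine\<close> is
  a supremum over the unit balls of \<open>U\<close> and \<open>V\<close>; by scaling it is then the constant in a strengthened
  Cauchy-Schwarz inequality.\<close>

lemma norm_ip_le_cosine:
  assumes U: "subspace U" and V: "subspace V" and UV: "U \<inter> V \<subseteq> {0}"
    and x: "x \<in> U" and y: "y \<in> V"
  shows "norm (ip x y) \<le> cosine ip U V * norm x * norm y" and "0 \<le> cosine ip U V"
proof -
  let ?A = "{norm (ip x y) |x y. x \<in> U \<inter> ortho ip (U \<inter> V) \<and> y \<in> V \<inter> ortho ip (U \<inter> V)
     \<and> norm x \<le> 1 \<and> norm y \<le> 1}"
  have ip0: "ip z 0 = 0" for z using ip_smul_right[of z 0 0] norm_ip_le[of z 0] by simp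
  have orth: "ortho ip (U \<inter> V) = UNIV" using UV by (auto simp: ortho_def ip0)
  have bdd: "bdd_above ?A"
  proof (rule bdd_aboveI[of _ 1])
    fix r assume "r \<in> ?A"
    then obtain x y where "r = norm (ip x y)" "norm x \<le> 1" "norm y \<le> 1" by blast
    then show "r \<le> 1" using norm_ip_le[of x y] mult_mono[of "norm x" 1 "norm y" 1] by simp
  qed
  have le: "norm (ip x y) \<le> cosine ip U V"
    if "x \<in> U" "y \<in> V" "norm x \<le> 1" "norm y \<le> 1" for x y
    unfolding cosine_def by (rule cSup_upper[OF _ bdd]) (use that orth in blast)
  from le[of 0 0] show "0 \<le> cosine ip U V" using subspace_0[OF U] subspace_0[OF V]
    by (simp add: ip0)
  show "norm (ip x y) \<le> cosine ip U V * norm x * norm y"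
  proof (cases "x = 0 \<or> y = 0")
    case True
    then show ?thesis using norm_ip_le[of x y] by auto
  next
    case False
    define r s where "r = inverse (norm x)" and "s = inverse (norm y)"
    have "norm (ip (r *\<^sub>R x) (s *\<^sub>R y)) \<le> cosine ip U V"
      using False x y U V by (intro le scaleR_mem) (auto simp: r_def s_def)
    also have "norm (ip (r *\<^sub>R x) (s *\<^sub>R y)) = r * s * norm (ip x y)"
      by (simp add: smul_of_real[symmetric] ip_smul_left ip_smul_right norm_mult norm_conjugate
          norm_inverse r_def s_def)
    finally show ?thesis using False by (simp add: r_def s_def field_simps)
  qed
qed

text \<open>The cosine only involves vectors of \<open>V\<close>, whereas the projection of \<open>u\<close> lies in its closure; the
  strengthened Cauchy-Schwarz inequality passes to the closure by continuity.\<close>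

lemma surj_if_cosine_less_1:
  assumes U: "closed_subspace U" and V: "subspace V" and UV: "U \<inter> V \<subseteq> {0}"
    and less: "cosine ip U V < 1"
  shows "U \<subseteq> proj ip U ` ortho ip V"
proof (rule surj_if_rip_proj_le[OF U V less])
  let ?c = "cosine ip U V" let ?P = "proj ip (closure V)"
  have Us: "subspace U" using U by (simp add: closed_subspace_def)
  fix u assume u: "u \<in> U"
  have "V \<subseteq> {y. rip u y \<le> ?c * norm u * norm y}"
    using norm_ip_le_cosine(1)[OF Us V UV u] rip_le_norm_ip order_trans by blast
  moreover have "closed {y. rip u y \<le> ?c * norm u * norm y}"
    by (intro closed_Collect_le continuous_intros
        bounded_linear.continuous_on[OF bounded_bilinear.bounded_linear_right[OF bounded_bilinear_rip]])
  ultimately have "closure V \<subseteq> {y. rip u y \<le> ?c * norm u * norm y}"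
    by (rule closure_minimal)
  then have "rip u (?P u) \<le> ?c * norm u * norm (?P u)"
    using proj_mem[OF closed_subspace_closure[OF V]] by blast
  also have "\<dots> \<le> ?c * norm u * norm u"
    using norm_proj_le[OF closed_subspace_closure[OF V]] norm_ip_le_cosine(2)[OF Us V UV u subspace_0[OF V]]
    by (intro mult_left_mono) auto
  finally show "rip (?P u) u \<le> ?c * (norm u)\<^sup>2"
    by (simp add: rip_commute power2_eq_square mult.assoc)
qed

section \<open>Closed sums\<close>

text \<open>The quadratic form of \<open>P_U + P_V\<close> is the sum of the squares of the norms of \<open>P_U x\<close> and \<open>P_V x\<close>, which
  dominates half the square of the sum of these norms.\<close>

lemma proj_sum_surj:
  assumes U: "closed_subspace U" and V: "closed_subspace V"
    and le: "\<And>z. z \<in> closure (U + V) \<Longrightarrow> norm z \<le> C * (norm (proj ip U z) + norm (proj ip V z))"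
    and z: "z \<in> closure (U + V)"
  shows "\<exists>x. proj ip U x + proj ip V x = z"
proof -
  let ?Z = "closure (U + V)"
  define D where "D = max C 1"
  have Us: "subspace U" "subspace V" using U V by (auto simp: closed_subspace_def)
  have Z: "closed_subspace ?Z" by (intro closed_subspace_closure subspace_set_plus Us)
  have UVZ: "U + V \<subseteq> ?Z" by (rule closure_subset)
  have "\<exists>x\<in>?Z. proj ip U x + proj ip V x = z"
  proof (rule coercive_surj[OF Z _ _ _ _ z, where a = "1 / (2 * D\<^sup>2)"])
    show "bounded_linear (\<lambda>x. proj ip U x + proj ip V x)"
      by (intro bounded_linear_add bounded_linear_proj U V)
    show "(\<lambda>x. proj ip U x + proj ip V x) ` ?Z \<subseteq> ?Z"
      using UVZ set_plus_intro[OF proj_mem[OF U] proj_mem[OF V]] by auto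
    show "1 / (2 * D\<^sup>2) > 0" by (simp add: D_def)
    fix x assume x: "x \<in> ?Z"
    let ?u = "norm (proj ip U x)" let ?v = "norm (proj ip V x)"
    have "norm x \<le> C * (?u + ?v)" by (rule le[OF x])
    also have "\<dots> \<le> D * (?u + ?v)" by (intro mult_right_mono) (auto simp: D_def)
    finally have D: "norm x \<le> D * (?u + ?v)" .
    have "(norm x)\<^sup>2 \<le> D\<^sup>2 * (?u + ?v)\<^sup>2"
      using power_mono[OF D, of 2] by (simp add: power_mult_distrib)
    also have "(?u + ?v)\<^sup>2 \<le> 2 * (?u\<^sup>2 + ?v\<^sup>2)"
      using zero_le_power2[of "?u - ?v"] by (simp add: power2_eq_square algebra_simps)
    finally have "(norm x)\<^sup>2 \<le> D\<^sup>2 * (2 * (?u\<^sup>2 + ?v\<^sup>2))" by (simp add: mult_left_mono)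
    then show "1 / (2 * D\<^sup>2) * (norm x)\<^sup>2 \<le> rip (proj ip U x + proj ip V x) x"
      by (simp add: rip_simps norm_proj_sq U V D_def field_simps)
  qed
  then show ?thesis by blast
qed

lemma closed_sum_if_proj_sum_surj:
  assumes U: "closed_subspace U" and V: "closed_subspace V"
    and surj: "\<And>z. z \<in> closure (U + V) \<Longrightarrow> \<exists>x. proj ip U x + proj ip V x = z"
  shows "closed (U + V)"
proof -
  have "closure (U + V) \<subseteq> U + V"
  proof
    fix z assume "z \<in> closure (U + V)"
    then obtain x where "proj ip U x + proj ip V x = z" using surj by blast
    then show "z \<in> U + V" using set_plus_intro[OF proj_mem[OF U] proj_mem[OF V], of x x] by simp
  qed
  then show ?thesis by (simp add: closure_subset_eq)
qed

text \<open>If \<open>P_U x + P_V x = u\<close> with \<open>u\<close> in \<open>U\<close>, then \<open>P_V x\<close> belongs to both subspaces and vanishes.\<close>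

lemma surj_if_proj_sum_surj:
  assumes U: "closed_subspace U" and V: "closed_subspace V" and UV: "U \<inter> V \<subseteq> {0}"
    and surj: "\<And>z. z \<in> closure (U + V) \<Longrightarrow> \<exists>x. proj ip U x + proj ip V x = z"
  shows "U \<subseteq> proj ip U ` ortho ip V"
proof
  fix u assume u: "u \<in> U"
  have Us: "subspace U" "subspace V" using U V by (auto simp: closed_subspace_def)
  have "u \<in> closure (U + V)"
    using set_plus_intro[OF u subspace_0[OF Us(2)]] closure_subset by auto
  then obtain x where x: "proj ip U x + proj ip V x = u" using surj by blast
  then have "proj ip V x = u - proj ip U x" by (simp add: algebra_simps)
  then have "proj ip V x \<in> U" using u proj_mem[OF U] Us by (simp add: subspace_diff)
  then have "proj ip V x = 0" using UV proj_mem[OF V] by blast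
  with x proj_diff_ortho[OF V, of x] show "u \<in> proj ip U ` ortho ip V" by auto
qed

text \<open>The distance to an orthogonal complement is the norm of a projection, and for \<open>z\<close> in the closure
  of \<open>U + V\<close> the nearest point of the complement of \<open>U + V\<close> is the origin.\<close>

lemma norm_le_if_linearly_regular:
  assumes U: "closed_subspace U" and V: "closed_subspace V" and g: "g > 0"
    and reg: "\<And>x. infdist x (ortho ip U \<inter> ortho ip V)
      \<le> g * (infdist x (ortho ip U) + infdist x (ortho ip V))"
    and z: "z \<in> closure (U + V)"
  shows "norm z \<le> g * (norm (proj ip U z) + norm (proj ip V z))"
proof -
  have Us: "subspace U" "subspace V" using U V by (auto simp: closed_subspace_def)
  have S: "subspace (U + V)" by (intro subspace_set_plus Us)
  have dist: "infdist z (ortho ip M) \<le> norm (proj ip M z)" if M: "closed_subspace M" for M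
    using infdist_le[OF proj_diff_ortho[OF M], of z z] by (simp add: dist_norm)
  have "norm z \<le> infdist z (ortho ip U \<inter> ortho ip V)"
  proof -
    have "0 \<in> ortho ip U \<inter> ortho ip V" by (intro IntI subspace_0 subspace_ortho)
    moreover have "norm z \<le> dist z y" if y: "y \<in> ortho ip U \<inter> ortho ip V" for y
    proof -
      have "y \<in> ortho ip (U + V)"
        using y Us S by (auto simp: ortho_iff_rip rip_simps elim!: set_plus_elim)
      then have "y \<in> ortho ip (closure (U + V))" by (simp add: ortho_closure[OF S])
      then have "rip y z = 0"
        using z closed_subspace_closure[OF S] by (auto simp: closed_subspace_def intro: rip_ortho_0)
      then have "(norm z)\<^sup>2 \<le> (norm (z - y))\<^sup>2"
        unfolding norm_diff_sq by (simp add: rip_commute)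
      then show ?thesis unfolding dist_norm by (rule power2_le_imp_le) simp
    qed
    ultimately show ?thesis by (auto simp: infdist_def intro!: cINF_greatest)
  qed
  also have "\<dots> \<le> g * (infdist z (ortho ip U) + infdist z (ortho ip V))" by (rule reg)
  also have "\<dots> \<le> g * (norm (proj ip U z) + norm (proj ip V z))"
    using g by (intro mult_left_mono add_mono dist U V) auto
  finally show ?thesis .
qed

text \<open>The first half of the open mapping theorem for the addition map on \<open>U \<times> V\<close>. The sets \<open>A n\<close> of
  sums whose first summand has norm at most \<open>n\<close> exhaust the complete space \<open>U + V\<close>, so some closure
  has interior points. Differences of points in it fill a ball around the origin, and scaling
  that ball gives the uniform constant. Approximate decompositions are enough for the
  estimate that follows, since it only tests them against a fixed vector.\<close>

lemma closed_sum_bounded_decomposition: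
  assumes U: "subspace U" and V: "subspace V" and cl: "closed (U + V)"
  shows "\<exists>C>0. \<forall>z\<in>U + V. z \<in> closure {u + v |u v. u \<in> U \<and> v \<in> V \<and> norm u \<le> C * norm z}"
proof -
  let ?Z = "U + V"
  define A where "A n = {u + v |u v. u \<in> U \<and> v \<in> V \<and> norm u \<le> n}" for n :: real
  let ?X = "top_of_set ?Z"
  have Z: "subspace ?Z" by (intro subspace_set_plus U V)
  have AI: "u + v \<in> A n" if "u \<in> U" "v \<in> V" "norm u \<le> n" for u v n
    using that by (auto simp: A_def)
  have AE: "\<exists>u\<in>U. \<exists>v\<in>V. x = u + v \<and> norm u \<le> n" if "x \<in> A n" for x n
    using that by (auto simp: A_def)
  have AZ: "closure (A n) \<subseteq> ?Z" for n
    by (rule closure_minimal[OF _ cl]) (auto simp: A_def)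
  have cover: "?Z = (\<Union>n. closure (A (real n)))"
  proof
    show "?Z \<subseteq> (\<Union>n. closure (A (real n)))"
    proof
      fix z assume "z \<in> ?Z"
      then obtain u v where uv: "u \<in> U" "v \<in> V" "z = u + v" by (auto elim: set_plus_elim)
      obtain n where "norm u \<le> real n" using real_arch_simple by blast
      then have "z \<in> A (real n)" using uv AI by simp
      then have "z \<in> closure (A (real n))" by (rule subsetD[OF closure_subset])
      then show "z \<in> (\<Union>n. closure (A (real n)))" by (rule UN_I[OF UNIV_I])
    qed
  qed (use AZ in blast)
  have "\<exists>n. ?X interior_of closure (A (real n)) \<noteq> {}"
  proof (rule ccontr)
    assume *: "\<not> ?thesis"
    have "?X interior_of \<Union>(range (\<lambda>n. closure (A (real n)))) = {}"
    proof (rule Baire_category_alt)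
      show "completely_metrizable_space ?X \<or> locally_compact_space ?X \<and> regular_space ?X"
        using completely_metrizable_space_closedin[OF completely_metrizable_space_euclidean
            cl[unfolded closed_closedin]] ..
      show "closedin ?X T \<and> ?X interior_of T = {}"
        if T: "T \<in> range (\<lambda>n. closure (A (real n)))" for T
      proof -
        obtain n where n: "T = closure (A (real n))" using T by blast
        then have "closedin ?X T" using AZ by (simp add: closed_subset)
        then show ?thesis using * n by simp
      qed
    qed simp
    then have "?X interior_of ?Z = {}" using cover by simp
    moreover have "?X interior_of ?Z = ?Z"
      using interior_of_topspace[of ?X] by simp
    ultimately show False using subspace_0[OF Z] by simp
  qed
  then obtain n z0 where "z0 \<in> ?X interior_of closure (A (real n))" by blast
  then obtain T where T: "openin ?X T" "z0 \<in> T" "T \<subseteq> closure (A (real n))"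
    by (auto simp: interior_of_def)
  then obtain r where r: "r > 0" "ball z0 r \<inter> ?Z \<subseteq> T"
    unfolding openin_contains_ball by blast
  have z0: "z0 \<in> ?Z" using T AZ by blast
  have AA: "x - y \<in> closure (A (2 * real n))"
    if x: "x \<in> closure (A (real n))" and y: "y \<in> closure (A (real n))" for x y
  proof -
    obtain f g where fg: "\<forall>k. f k \<in> A (real n)" "f \<longlonglongrightarrow> x" "\<forall>k. g k \<in> A (real n)" "g \<longlonglongrightarrow> y"
      using x y unfolding closure_sequential by (elim exE conjE)
    have "f k - g k \<in> A (2 * real n)" for k
    proof -
      obtain u v where uv: "u \<in> U" "v \<in> V" "f k = u + v" "norm u \<le> real n"
        using AE[OF fg(1)[rule_format]] by blast
      obtain u' v' where uv': "u' \<in> U" "v' \<in> V" "g k = u' + v'" "norm u' \<le> real n"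
        using AE[OF fg(3)[rule_format]] by blast
      have "norm (u - u') \<le> 2 * real n"
        using norm_triangle_ineq4[of u u'] uv uv' by simp
      then have "(u - u') + (v - v') \<in> A (2 * real n)"
        using uv uv' by (intro AI subspace_diff U V) auto
      then show ?thesis unfolding uv(3) uv'(3) by (simp only: add_diff_add)
    qed
    moreover have "(\<lambda>k. f k - g k) \<longlonglongrightarrow> x - y" using fg by (intro tendsto_diff)
    ultimately show ?thesis unfolding closure_sequential by (intro exI conjI allI)
  qed
  \<comment> \<open>Halving the radius makes room for the vectors of norm exactly \<open>s\<close>, to which
    nonzero vectors are scaled below.\<close>
  define s where "s = r / 2"
  have s: "s > 0" using r by (simp add: s_def)
  have small: "z \<in> closure (A (2 * real n))" if z: "z \<in> ?Z" "norm z \<le> s" for z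
  proof -
    have "z0 + z \<in> ball z0 r" using z r by (simp add: dist_norm s_def)
    moreover have "z0 + z \<in> ?Z" using z z0 subspace_add[OF Z] by simp
    ultimately have "z0 + z \<in> closure (A (real n))" using r T by auto
    then show ?thesis using AA[of "z0 + z" z0] T by auto
  qed
  \<comment> \<open>The summand 1 ensures positivity when \<open>n = 0\<close>.\<close>
  define C where "C = 2 * real n / s + 1"
  have "C > 0" using s by (simp add: C_def add_nonneg_pos)
  moreover have "z \<in> closure (A (C * norm z))" if z: "z \<in> ?Z" for z
  proof (cases "z = 0")
    case True
    then have "z \<in> A (C * norm z)"
      using AI[OF subspace_0[OF U] subspace_0[OF V]] by simp
    then show ?thesis by (rule subsetD[OF closure_subset])
  next
    case False
    define t where "t = norm z / s"
    have t: "t > 0" using False s by (simp add: t_def)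
    have "inverse t *\<^sub>R z \<in> closure (A (2 * real n))"
      using s False by (intro small scaleR_mem Z z) (simp add: t_def)
    then obtain f where f: "\<forall>k. f k \<in> A (2 * real n)" "f \<longlonglongrightarrow> inverse t *\<^sub>R z"
      unfolding closure_sequential by (elim exE conjE)
    have "t *\<^sub>R f k \<in> A (C * norm z)" for k
    proof -
      obtain u v where uv: "u \<in> U" "v \<in> V" "f k = u + v" "norm u \<le> 2 * real n"
        using AE[OF f(1)[rule_format]] by blast
      have "norm (t *\<^sub>R u) \<le> t * (2 * real n)" using uv t by simp
      also have "\<dots> \<le> C * norm z" using s by (simp add: t_def C_def field_simps)
      finally have "t *\<^sub>R u + t *\<^sub>R v \<in> A (C * norm z)"
        using uv by (intro AI scaleR_mem U V)
      then show ?thesis by (simp add: uv scaleR_add_right)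
    qed
    moreover have "(\<lambda>k. t *\<^sub>R f k) \<longlonglongrightarrow> z"
      using tendsto_scaleR[OF tendsto_const f(2), of t] t by simp
    ultimately show ?thesis unfolding closure_sequential by (intro exI conjI allI)
  qed
  ultimately show ?thesis unfolding A_def by (intro exI[of _ C] conjI ballI)
qed

text \<open>Take the real inner product of \<open>z\<close> with approximate decompositions \<open>u + v\<close> of \<open>z\<close> itself: against \<open>u\<close>
  only \<open>P_U z\<close> counts, against \<open>v\<close> only \<open>P_V z\<close>, and both summands are bounded by a multiple of
  the norm of \<open>z\<close>.\<close>

lemma norm_le_if_closed_sum:
  assumes U: "closed_subspace U" and V: "closed_subspace V" and cl: "closed (U + V)"
  obtains C where "\<And>z. z \<in> closure (U + V) \<Longrightarrow> norm z \<le> C * (norm (proj ip U z) + norm (proj ip V z))"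
proof -
  have Us: "subspace U" "subspace V" using U V by (auto simp: closed_subspace_def)
  obtain C where C: "C > 0" "\<forall>z\<in>U + V.
      z \<in> closure {u + v |u v. u \<in> U \<and> v \<in> V \<and> norm u \<le> C * norm z}"
    using closed_sum_bounded_decomposition[OF Us cl] by (elim exE conjE)
  show thesis
  proof
    fix z assume "z \<in> closure (U + V)"
    then have z: "z \<in> U + V" using cl by simp
    let ?p = "norm (proj ip U z)" let ?q = "norm (proj ip V z)" let ?D = "C + 1"
    show "norm z \<le> ?D * (?p + ?q)"
    proof (cases "z = 0")
      case False
      obtain f where f: "\<forall>k. f k \<in> {u + v |u v. u \<in> U \<and> v \<in> V \<and> norm u \<le> C * norm z}"
        and lim: "f \<longlonglongrightarrow> z"
        using C(2)[rule_format, OF z] unfolding closure_sequential by (elim exE conjE)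
      have "rip (f k) z \<le> C * norm z * ?p + (norm (f k) + C * norm z) * ?q" for k
      proof -
        obtain u v where uv: "u \<in> U" "v \<in> V" "norm u \<le> C * norm z" "f k = u + v"
          using f[rule_format, of k] by blast
        have "rip (proj ip U z) u \<le> norm u * ?p" "rip (proj ip V z) v \<le> norm v * ?q"
          using rip_le[of "proj ip U z" u] rip_le[of "proj ip V z" v] by (simp_all add: mult.commute)
        then have "rip u z \<le> norm u * ?p" "rip v z \<le> norm v * ?q"
          using uv by (simp_all add: rip_proj U V rip_commute[of z])
        moreover have "norm u * ?p \<le> C * norm z * ?p" using uv by (intro mult_right_mono) auto
        moreover have "norm v \<le> norm (f k) + C * norm z"
          using norm_triangle_ineq4[of "f k" u] uv by simp
        then have "norm v * ?q \<le> (norm (f k) + C * norm z) * ?q" by (intro mult_right_mono) auto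
        ultimately show ?thesis by (simp add: uv rip_simps)
      qed
      moreover have "(\<lambda>k. rip (f k) z) \<longlonglongrightarrow> rip z z"
        by (rule bounded_linear.tendsto[OF bounded_bilinear.bounded_linear_left[OF bounded_bilinear_rip] lim])
      moreover have "(\<lambda>k. C * norm z * ?p + (norm (f k) + C * norm z) * ?q)
          \<longlonglongrightarrow> C * norm z * ?p + (norm z + C * norm z) * ?q"
        by (intro tendsto_intros lim)
      ultimately have "rip z z \<le> C * norm z * ?p + (norm z + C * norm z) * ?q"
        by (intro LIMSEQ_le) auto
      then have "norm z * norm z \<le> norm z * (C * ?p + (1 + C) * ?q)"
        by (simp add: rip_self power2_eq_square algebra_simps)
      then have "norm z \<le> C * ?p + (1 + C) * ?q" using False by simp
      also have "\<dots> \<le> (C + 1) * (?p + ?q)" by (simp add: algebra_simps)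
      finally show ?thesis .
    qed (use C in simp)
  qed
qed

end

section \<open>Families of subspaces\<close>

lemma tail_sum_Suc:
  assumes "i < m"
  shows "tail_sum m U i = U (Suc i) + tail_sum m U (Suc i)"
  using assms by (simp add: tail_sum_def sum.atLeast_Suc_atMost)

lemma tail_sum_last: "tail_sum m U m = 0"
  by (simp add: tail_sum_def)

context hilbert_space
begin

lemma subspace_tail_sum:
  assumes "\<And>i. i \<in> {1..m} \<Longrightarrow> subspace (U i)"
  shows "subspace (tail_sum m U i)"
proof -
  have "subspace (\<Sum>j\<in>J. U j)" if "finite J" "J \<subseteq> {1..m}" for J
    using that
  proof (induction J rule: finite_induct)
    case (insert j J)
    then show ?case using assms[of j] by (simp add: subspace_set_plus)
  qed (simp add: set_zero)
  then show ?thesis unfolding tail_sum_def by (simp add: subset_iff)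
qed

lemma subset_tail_sum:
  assumes U: "\<And>i. i \<in> {1..m} \<Longrightarrow> subspace (U i)" and j: "j \<in> {i+1..m}"
  shows "U j \<subseteq> tail_sum m U i"
proof
  fix x assume x: "x \<in> U j"
  let ?w = "\<lambda>k. if k = j then x else 0"
  have "\<forall>k\<in>{i+1..m}. ?w k \<in> U k" using x by (auto intro!: subspace_0 U)
  moreover have "x = (\<Sum>k\<in>{i+1..m}. ?w k)" using j by simp
  ultimately show "x \<in> tail_sum m U i"
    unfolding tail_sum_def set_sum_alt[OF finite_atLeastAtMost] by blast
qed

text \<open>Downward induction: a point solving the equations after \<open>k + 1\<close> is corrected at index \<open>k + 1\<close> by
  a vector whose later projections vanish, so the equations solved before stay solved.\<close>

lemma IBAP_if_successive:
  assumes U: "\<And>i. i \<in> {1..m} \<Longrightarrow> closed_subspace (U i)"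
    and step: "\<And>i u. i \<in> {1..m-1} \<Longrightarrow> u \<in> U i \<Longrightarrow>
      \<exists>x. proj ip (U i) x = u \<and> (\<forall>j\<in>{i+1..m}. proj ip (U j) x = 0)"
  shows "IBAP ip m U"
  unfolding IBAP_def
proof (intro allI impI)
  fix u assume u: "\<forall>i\<in>{1..m}. u i \<in> U i"
  have Us: "subspace (U i)" if "i \<in> {1..m}" for i using U[OF that] by (simp add: closed_subspace_def)
  have "\<exists>x. \<forall>i\<in>{Suc k..m}. proj ip (U i) x = u i" if "k \<le> m" for k
    using that
  proof (induction k rule: inc_induct)
    case (step k)
    then obtain y where y: "\<And>i. i \<in> {Suc (Suc k)..m} \<Longrightarrow> proj ip (U i) y = u i" by blast
    let ?v = "u (Suc k) - proj ip (U (Suc k)) y"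
    have k: "Suc k \<in> {1..m}" using step by simp
    have v: "?v \<in> U (Suc k)"
      using u k by (intro subspace_diff Us proj_mem U) auto
    obtain x where x: "proj ip (U (Suc k)) x = ?v"
        "\<And>j. j \<in> {Suc (Suc k)..m} \<Longrightarrow> proj ip (U j) x = 0"
    \<comment> \<open>The hypothesis does not cover the last index, but there no later projection has to vanish.\<close>
    proof (cases "Suc k = m")
      case True
      then show thesis using that[of ?v] proj_id[OF U[OF k] v] by simp
    next
      case False
      then have "Suc k \<in> {1..m-1}" using step.hyps by auto
      from assms(2)[OF this v] show thesis using that by auto
    qed
    have "proj ip (U i) (y + x) = u i" if i: "i \<in> {Suc k..m}" for i
    proof (cases "i = Suc k")
      case True
      then show ?thesis using x by (simp add: proj_add U[OF k])
    next
      case False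
      then have "i \<in> {Suc (Suc k)..m}" using i by simp
      then show ?thesis using x y i by (simp add: proj_add U)
    qed
    then show ?case by blast
  qed simp
  from this[of 0] show "\<exists>x. \<forall>i\<in>{1..m}. proj ip (U i) x = u i" by simp
qed

lemma IBAP_if_surj:
  assumes U: "\<And>i. i \<in> {1..m} \<Longrightarrow> closed_subspace (U i)"
    and surj: "\<And>i. i \<in> {1..m-1} \<Longrightarrow> U i \<subseteq> proj ip (U i) ` ortho ip (tail_sum m U i)"
  shows "IBAP ip m U"
proof (rule IBAP_if_successive[OF U])
  fix i u assume i: "i \<in> {1..m-1}" and u: "u \<in> U i"
  obtain x where x: "x \<in> ortho ip (tail_sum m U i)" "proj ip (U i) x = u"
    using surj[OF i] u by blast
  have "proj ip (U j) x = 0" if j: "j \<in> {i+1..m}" for j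
  proof (rule proj_ortho_0)
    show "closed_subspace (U j)" using U j by simp
    have "U j \<subseteq> tail_sum m U i"
      using U j by (intro subset_tail_sum) (auto simp: closed_subspace_def)
    then show "x \<in> ortho ip (U j)" using x by (auto simp: ortho_def)
  qed
  with x show "\<exists>x. proj ip (U i) x = u \<and> (\<forall>j\<in>{i+1..m}. proj ip (U j) x = 0)" by blast
qed

lemma surj_if_ortho_sum:
  assumes U: "closed_subspace U" and sum: "ortho ip U + ortho ip V = UNIV"
  shows "U \<subseteq> proj ip U ` ortho ip V"
proof
  fix u assume u: "u \<in> U"
  obtain v w where vw: "v \<in> ortho ip U" "w \<in> ortho ip V" "u = v + w"
    using sum by (metis UNIV_I set_plus_elim)
  then have "proj ip U w = u"
    using proj_add[OF U, of v w] proj_ortho_0[OF U vw(1)] proj_id[OF U u] by simp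
  then show "u \<in> proj ip U ` ortho ip V" using vw(2) by (metis imageI)
qed

lemma tail_sum_elem:
  assumes "v \<in> tail_sum m U i"
  obtains w where "\<And>j. j \<in> {i+1..m} \<Longrightarrow> w j \<in> U j" "v = (\<Sum>j\<in>{i+1..m}. w j)"
  using assms unfolding tail_sum_def set_sum_alt[OF finite_atLeastAtMost] by blast

lemma lin_independent_Int_tail_sum:
  assumes li: "lin_independent m U" and U: "\<And>i. i \<in> {1..m} \<Longrightarrow> subspace (U i)"
    and i: "i \<in> {1..m-1}"
  shows "U i \<inter> tail_sum m U i \<subseteq> {0}"
proof
  fix v assume v: "v \<in> U i \<inter> tail_sum m U i"
  then obtain w where w: "\<And>j. j \<in> {i+1..m} \<Longrightarrow> w j \<in> U j" "v = (\<Sum>j\<in>{i+1..m}. w j)"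
    by (blast elim: tail_sum_elem)
  \<comment> \<open>Moving \<open>v\<close> to the other side of \<open>v = \<Sum> w j\<close> gives a vanishing sum.\<close>
  define u where "u j = (if j = i then - v else if j < i then 0 else w j)" for j
  have mem: "\<forall>j\<in>{1..m}. u j \<in> U j"
    using v w(1) U by (auto simp: u_def subspace_0 subspace_neg)
  have "(\<Sum>j\<in>{1..m}. u j) = (\<Sum>j\<in>insert i {i+1..m}. u j)"
    using i by (intro sum.mono_neutral_right) (auto simp: u_def)
  also have "\<dots> = - v + (\<Sum>j\<in>{i+1..m}. w j)"
    by (simp add: u_def)
  finally have "(\<Sum>j\<in>{1..m}. u j) = 0" using w by simp
  then have "u i = 0" using li mem i unfolding lin_independent_def by auto
  then show "v \<in> {0}" by (simp add: u_def)
qed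

text \<open>The sum of the subspaces after \<open>m - 1\<close> is the closed subspace \<open>U m\<close>, and \<open>U i\<close> plus the sum after \<open>i\<close> is
  the sum after \<open>i - 1\<close>.\<close>

lemma closed_tail_sum:
  assumes U: "\<And>i. i \<in> {1..m} \<Longrightarrow> closed_subspace (U i)"
    and step: "\<And>i. i \<in> {1..m-1} \<Longrightarrow> closed (tail_sum m U i) \<Longrightarrow> closed (U i + tail_sum m U i)"
    and i: "i \<in> {1..m-1}"
  shows "closed (tail_sum m U i)"
proof -
  have "i \<le> m - 1" using i by simp
  then show ?thesis using i
  proof (induction i rule: inc_induct)
    case base
    then have m: "m - 1 < m" "Suc (m - 1) = m" "m \<in> {1..m}" by auto
    have "tail_sum m U (m - 1) = U m"
      using tail_sum_Suc[OF m(1), of U] unfolding m(2) tail_sum_last by simp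
    then show ?case using U[OF m(3)] by (simp only: closed_subspace_def)
  next
    case (step k)
    then have k: "k < m" "Suc k \<in> {1..m-1}" by auto
    show ?case
      unfolding tail_sum_Suc[OF k(1)] by (rule assms(2)[OF k(2) step.IH[OF k(2)]])
  qed
qed

text \<open>Solvability of \<open>P_U x + P_V x = z\<close> may be proved under the assumption that \<open>V\<close> is closed, because
  it makes the next sum closed in turn.\<close>

lemma surj_if_independent_and_proj_sum_surj:
  assumes U: "\<And>i. i \<in> {1..m} \<Longrightarrow> closed_subspace (U i)" and li: "lin_independent m U"
    and surj: "\<And>i z. i \<in> {1..m-1} \<Longrightarrow> closed (tail_sum m U i) \<Longrightarrow>
      z \<in> closure (U i + tail_sum m U i) \<Longrightarrow>
      \<exists>x. proj ip (U i) x + proj ip (tail_sum m U i) x = z"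
    and i: "i \<in> {1..m-1}"
  shows "U i \<subseteq> proj ip (U i) ` ortho ip (tail_sum m U i)"
proof -
  have Us: "subspace (U i)" if "i \<in> {1..m}" for i using U[OF that] by (simp add: closed_subspace_def)
  have Ui: "closed_subspace (U i)" if "i \<in> {1..m-1}" for i using U[of i] that by auto
  have cs: "closed_subspace (tail_sum m U i)" if "closed (tail_sum m U i)" for i
    using subspace_tail_sum[OF Us] that by (simp add: closed_subspace_def)
  have cl: "closed (tail_sum m U i)"
  proof (rule closed_tail_sum[OF U _ i])
    fix k assume k: "k \<in> {1..m-1}" "closed (tail_sum m U k)"
    show "closed (U k + tail_sum m U k)"
      by (rule closed_sum_if_proj_sum_surj[OF Ui[OF k(1)] cs[OF k(2)] surj[OF k]])
  qed
  show ?thesis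
    by (rule surj_if_proj_sum_surj[OF Ui[OF i] cs[OF cl]
          lin_independent_Int_tail_sum[OF li Us i] surj[OF i cl]])
qed

lemma parallel_subspace_translate:
  assumes "subspace M"
  shows "parallel_subspace ((\<lambda>v. a + v) ` M) = M"
proof
  show "parallel_subspace ((\<lambda>v. a + v) ` M) \<subseteq> M"
    using assms by (auto simp: parallel_subspace_def subspace_diff)
  show "M \<subseteq> parallel_subspace ((\<lambda>v. a + v) ` M)"
  proof
    fix x assume "x \<in> M"
    then have "x = (a + x) - (a + 0)" "a + x \<in> (\<lambda>v. a + v) ` M" "a + 0 \<in> (\<lambda>v. a + v) ` M"
      using subspace_0[OF assms] by (simp, blast, blast)
    then show "x \<in> parallel_subspace ((\<lambda>v. a + v) ` M)"
      unfolding parallel_subspace_def by blast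
  qed
qed

lemma closed_affine_orthoE:
  assumes "closed_affine smul S"
  obtains a M where "closed_subspace M" "S = (\<lambda>v. a + v) ` M"
    "ortho ip (parallel_subspace S) = ortho ip M"
  using assms parallel_subspace_translate unfolding closed_affine_def closed_subspace_def by metis

text \<open>A point belongs to \<open>a + M\<close> if and only if it has the same projection as \<open>a\<close> onto the complement
  of \<open>M\<close>; so membership in all the affine subspaces is an instance of the property.\<close>

lemma IBAP_imp_Inter_nonempty:
  assumes S: "\<And>i. i \<in> {1..m} \<Longrightarrow> closed_affine smul (S i)"
    and U: "\<And>i. i \<in> {1..m} \<Longrightarrow> U i = ortho ip (parallel_subspace (S i))"
    and ibap: "IBAP ip m U"
  shows "(\<Inter>i\<in>{1..m}. S i) \<noteq> {}"
proof -
  have "\<forall>i\<in>{1..m}. \<exists>a. \<exists>M. closed_subspace M \<and> S i = (\<lambda>v. a + v) ` M \<and> U i = ortho ip M"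
    using S U closed_affine_orthoE by metis
  from bchoice[OF this] obtain a
    where "\<forall>i\<in>{1..m}. \<exists>M. closed_subspace M \<and> S i = (\<lambda>v. a i + v) ` M \<and> U i = ortho ip M" ..
  from bchoice[OF this] obtain M
    where "\<forall>i\<in>{1..m}. closed_subspace (M i) \<and> S i = (\<lambda>v. a i + v) ` M i \<and> U i = ortho ip (M i)" ..
  then have M: "closed_subspace (M i)" and SM: "S i = (\<lambda>v. a i + v) ` M i" and UM: "U i = ortho ip (M i)"
    if "i \<in> {1..m}" for i
    using that by blast+
  have Uc: "closed_subspace (U i)" if "i \<in> {1..m}" for i
    using closed_subspace_ortho[of "M i"] M[OF that] UM[OF that] by (simp add: closed_subspace_def)
  have "\<forall>i\<in>{1..m}. proj ip (U i) (a i) \<in> U i" using Uc proj_mem by blast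
  then obtain x where x: "\<forall>i\<in>{1..m}. proj ip (U i) x = proj ip (U i) (a i)"
    using ibap[unfolded IBAP_def, THEN spec, of "\<lambda>i. proj ip (U i) (a i)"] by blast
  have "x \<in> S i" if i: "i \<in> {1..m}" for i
  proof -
    have "proj ip (U i) (x - a i) = 0"
      using proj_add[OF Uc[OF i], of "x - a i" "a i"] x i by simp
    then have "x - a i \<in> ortho ip (U i)"
      using proj_diff_ortho[OF Uc[OF i], of "x - a i"] by simp
    then have "x - a i \<in> M i" using ortho_ortho[OF M[OF i]] UM[OF i] by simp
    then show ?thesis unfolding SM[OF i] by (intro image_eqI[of _ _ "x - a i"]) simp_all
  qed
  then show ?thesis by blast
qed

end

theorem proposition2p10:
  fixes smul :: "'k::real_or_complex \<Rightarrow> 'a::banach \<Rightarrow> 'a"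
    and ip :: "'a \<Rightarrow> 'a \<Rightarrow> 'k"
    and m :: nat
    and S U :: "nat \<Rightarrow> 'a set"
  assumes "hilbert_space smul ip"
    and "m \<ge> 1"
    and "\<And>i. i \<in> {1..m} \<Longrightarrow> closed_affine smul (S i)"
    and "\<And>i. i \<in> {1..m} \<Longrightarrow> U i = ortho ip (parallel_subspace (S i))"
  shows "(IBAP ip m U \<longrightarrow> (\<Inter>i\<in>{1..m}. S i) \<noteq> {}) \<and>
    (
      \<comment> \<open>(a)\<close>
      (\<forall>i\<in>{1..m-1}. \<forall>u\<in>U i. \<exists>x.
         proj ip (U i) x = u \<and> (\<forall>j\<in>{i+1..m}. proj ip (U j) x = 0))
      \<comment> \<open>(b)\<close>
      \<or> (\<forall>i\<in>{1..m-1}. proj ip (U i) ` ortho ip (tail_sum m U i) = U i)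
      \<comment> \<open>(c)\<close>
      \<or> (\<forall>i\<in>{1..m-1}. ortho ip (U i) + ortho ip (tail_sum m U i) = UNIV)
      \<comment> \<open>(d)\<close>
      \<or> (lin_independent m U \<and>
         (\<forall>i\<in>{1..m-1}. \<exists>\<gamma>::real. \<gamma> > 0 \<and> (\<forall>x.
            infdist x (ortho ip (U i) \<inter> ortho ip (tail_sum m U i))
              \<le> \<gamma> * (infdist x (ortho ip (U i)) + infdist x (ortho ip (tail_sum m U i))))))
      \<comment> \<open>(e)\<close>
      \<or> (lin_independent m U \<and> (\<forall>i\<in>{1..m-1}. closed (U i + tail_sum m U i)))
      \<comment> \<open>(f)\<close>
      \<or> (lin_independent m U \<and> (\<forall>i\<in>{1..m-1}. cosine ip (U i) (tail_sum m U i) < 1))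
      \<comment> \<open>(g)\<close>
      \<or> (\<forall>i\<in>{1..m-1}. \<exists>\<gamma>::real. \<gamma> \<ge> 1 \<and> (\<forall>u\<in>U i.
           norm u \<le> \<gamma> * norm (proj ip (ortho ip (tail_sum m U i)) u)))
      \<comment> \<open>(h)\<close>
      \<or> (\<forall>i\<in>{1..m-1}. \<exists>\<gamma>::real. \<gamma> \<ge> 2 \<and> (\<forall>x.
           norm x \<le> \<gamma> * (norm (proj ip (ortho ip (U i)) x)
                         + norm (proj ip (ortho ip (tail_sum m U i)) x))))
      \<comment> \<open>(i)\<close>
      \<or> (\<forall>i\<in>{1..m-1}. onorm (proj ip (U i) \<circ> proj ip (closure (tail_sum m U i))) < 1)
      \<longrightarrow> (\<Inter>i\<in>{1..m}. S i) \<noteq> {})"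
proof -
  interpret hilbert_space smul ip by fact
  let ?V = "tail_sum m U"
  have Uc: "closed_subspace (U i)" if i: "i \<in> {1..m}" for i
  proof -
    obtain a M where "closed_subspace M" "ortho ip (parallel_subspace (S i)) = ortho ip M"
      using closed_affine_orthoE[OF assms(3)[OF i]] by metis
    then show ?thesis using assms(4)[OF i] closed_subspace_ortho by (simp add: closed_subspace_def)
  qed
  then have Us: "subspace (U i)" if "i \<in> {1..m}" for i
    using that by (simp add: closed_subspace_def)
  have U: "closed_subspace (U i)" if "i \<in> {1..m-1}" for i using Uc[of i] that by auto
  have V: "subspace (?V i)" for i by (rule subspace_tail_sum[OF Us])
  have Vc: "closed_subspace (?V i)" if "closed (?V i)" for i
    using V that by (simp add: closed_subspace_def)
  have ind: "U i \<inter> ?V i \<subseteq> {0}" if "lin_independent m U" "i \<in> {1..m-1}" for i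
    using lin_independent_Int_tail_sum[OF that(1) Us that(2)] .
  have nonempty: "(\<Inter>i\<in>{1..m}. S i) \<noteq> {}" if "IBAP ip m U"
    using IBAP_imp_Inter_nonempty[OF assms(3,4) that] .
  have surjI: "IBAP ip m U"
    if "\<And>i. i \<in> {1..m-1} \<Longrightarrow> U i \<subseteq> proj ip (U i) ` ortho ip (?V i)"
    using Uc that by (rule IBAP_if_surj)
  show ?thesis
  proof (intro conjI impI nonempty, assumption, elim disjE, goal_cases)
    case 1
    then show ?case using IBAP_if_successive[of m U, OF Uc] by blast
  next
    case 2
    show ?case by (rule surjI[OF equalityD2[OF bspec[OF 2]]])
  next
    case 3
    show ?case by (rule surjI[OF surj_if_ortho_sum[OF U bspec[OF 3]]])
  next
    case 4
    then have li: "lin_independent m U" and reg: "\<And>i. i \<in> {1..m-1} \<Longrightarrow> \<exists>g>0. \<forall>x.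
        infdist x (ortho ip (U i) \<inter> ortho ip (?V i))
          \<le> g * (infdist x (ortho ip (U i)) + infdist x (ortho ip (?V i)))"
      by blast+
    show ?case
    proof (rule surjI, rule surj_if_independent_and_proj_sum_surj[OF Uc li])
      fix i z assume i: "i \<in> {1..m-1}" and cl: "closed (?V i)" and z: "z \<in> closure (U i + ?V i)"
      obtain g where g: "g > 0" "\<And>x. infdist x (ortho ip (U i) \<inter> ortho ip (?V i))
          \<le> g * (infdist x (ortho ip (U i)) + infdist x (ortho ip (?V i)))"
        using reg[OF i] by blast
      show "\<exists>x. proj ip (U i) x + proj ip (?V i) x = z"
        by (rule proj_sum_surj[OF U[OF i] Vc[OF cl]
              norm_le_if_linearly_regular[OF U[OF i] Vc[OF cl] g] z])
    qed
  next
    case 5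
    then have li: "lin_independent m U"
      and sum_closed: "\<And>i. i \<in> {1..m-1} \<Longrightarrow> closed (U i + ?V i)" by blast+
    show ?case
    proof (rule surjI, rule surj_if_independent_and_proj_sum_surj[OF Uc li])
      fix i z assume i: "i \<in> {1..m-1}" and cl: "closed (?V i)" and z: "z \<in> closure (U i + ?V i)"
      obtain C where "\<And>z. z \<in> closure (U i + ?V i)
          \<Longrightarrow> norm z \<le> C * (norm (proj ip (U i) z) + norm (proj ip (?V i) z))"
        using norm_le_if_closed_sum[OF U[OF i] Vc[OF cl] sum_closed[OF i]] by blast
      from proj_sum_surj[OF U[OF i] Vc[OF cl] this z]
      show "\<exists>x. proj ip (U i) x + proj ip (?V i) x = z" .
    qed
  next
    case 6
    then have li: "lin_independent m U"
      and less: "\<forall>i\<in>{1..m-1}. cosine ip (U i) (?V i) < 1" by blast+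
    show ?case
      by (rule surjI[OF surj_if_cosine_less_1[OF U V ind[OF li] bspec[OF less]]])
  next
    case 7
    show ?case
    proof (rule surjI)
      fix i assume i: "i \<in> {1..m-1}"
      obtain g where "g \<ge> 1" "\<forall>u\<in>U i. norm u \<le> g * norm (proj ip (ortho ip (?V i)) u)"
        using 7 i by blast
      then show "U i \<subseteq> proj ip (U i) ` ortho ip (?V i)"
        by (intro surj_if_norm_le[of _ _ g] U V i) auto
    qed
  next
    case 8
    show ?case
    proof (rule surjI)
      fix i assume i: "i \<in> {1..m-1}"
      obtain g where g: "g \<ge> 2" "\<forall>x. norm x \<le> g * (norm (proj ip (ortho ip (U i)) x)
          + norm (proj ip (ortho ip (?V i)) x))"
        using 8 i by blast
      \<comment> \<open>On \<open>U i\<close> the first projection vanishes, which leaves the bound of case (g).\<close>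
      have "norm u \<le> g * norm (proj ip (ortho ip (?V i)) u)" if "u \<in> U i" for u
        using g(2)[rule_format, of u] that
        by (simp add: proj_ortho[OF U[OF i]] proj_id[OF U[OF i]])
      then show "U i \<subseteq> proj ip (U i) ` ortho ip (?V i)"
        using g(1) by (intro surj_if_norm_le[of _ _ g] U V i) auto
    qed
  next
    case 9
    show ?case by (rule surjI[OF surj_if_onorm_less_1[OF U V bspec[OF 9]]])
  qed
qed

end
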